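(* Let $X$ be an implicative-orthomodular lattice. Then its center $\mathcal{CC}(X)=\{x\in X\mid x\,\mathcal{C}\,y\text{ for all }y\in X\}$ is an implicative-Boolean subalgebra of $X$.
   Context: A BE algebra is an algebra $(X,\to,1)$ such that for all $x,y,z\in X$: $x\to x=1$; $x\to 1=1$; $1\to x=x$; $x\to(y\to z)=y\to(x\to z)$. It carries the relation $x\le y$ iff $x\to y=1$. It is bounded if there is $0\in X$ with $0\le x$ for all $x\in X$; then $x^*:=x\to 0$ (so $0=1^*$) and the algebra is written $(X,\to,{}^*,1)$. It is involutive if $x^{**}=x$ for all $x$, and implicative if $(x\to y)\to x=x$ for all $x,y$. An implicative-ortholattice is an implicative involutive (bounded) BE algebra. Put $x\wedge_Q y:=((x^*\to y^* )\to y^* )^*$. An implicative-orthomodular lattice is an implicative-ortholattice with $x\wedge_Q(y\to x)=x$ for all $x,y$. An implicative-Boolean algebra is an implicative-ortholattice with $(y^*\to x)\to y=x\to y$ for all $x,y$. An implicative-Boolean subalgebra of $X$ is a subset containing $0,1$ and closed under $\to$ (hence under $^*$) which is an implicative-Boolean algebra under the restricted operations. The commutativity relation: $x\,\mathcal{C}\,y$ iff $y\wedge_Q x=(x\to y^* )^*$. *)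

theory Defs
  imports Main
begin

text \<open>
  Algebras are given by a carrier set \<open>X\<close>, so that a subalgebra is a subset of the same type with
  the same operations.  On a bounded algebra the element \<open>\<zero>\<close> is part of the signature: the relation
  \<open>\<sqsubseteq>\<close> of a BE algebra need not be antisymmetric, so boundedness alone does not determine a least
  element.
\<close>

locale BE_algebra =
  fixes X :: "'a set"
    and imp :: "'a \<Rightarrow> 'a \<Rightarrow> 'a"  (infixr "\<rightarrow>" 70)
    and one :: 'a  ("\<one>")
  assumes imp_closed: "\<lbrakk>x \<in> X; y \<in> X\<rbrakk> \<Longrightarrow> x \<rightarrow> y \<in> X"
    and one_closed: "\<one> \<in> X"
    and imp_refl: "x \<in> X \<Longrightarrow> x \<rightarrow> x = \<one>"
    and imp_one: "x \<in> X \<Longrightarrow> x \<rightarrow> \<one> = \<one>"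
    and one_imp: "x \<in> X \<Longrightarrow> \<one> \<rightarrow> x = x"
    and imp_exchange: "\<lbrakk>x \<in> X; y \<in> X; z \<in> X\<rbrakk> \<Longrightarrow> x \<rightarrow> (y \<rightarrow> z) = y \<rightarrow> (x \<rightarrow> z)"
begin

definition le :: "'a \<Rightarrow> 'a \<Rightarrow> bool"  (infix "\<sqsubseteq>" 50)
  where "x \<sqsubseteq> y \<longleftrightarrow> x \<rightarrow> y = \<one>"

end

locale bounded_BE_algebra = BE_algebra X imp one
  for X :: "'a set"
    and imp :: "'a \<Rightarrow> 'a \<Rightarrow> 'a"  (infixr "\<rightarrow>" 70)
    and one :: 'a  ("\<one>") +
  fixes zero :: 'a  ("\<zero>")
  assumes zero_closed: "\<zero> \<in> X"
    and zero_le: "x \<in> X \<Longrightarrow> \<zero> \<sqsubseteq> x"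
begin

definition neg :: "'a \<Rightarrow> 'a"  ("_\<^sup>\<star>" [999] 999)
  where "x\<^sup>\<star> = x \<rightarrow> \<zero>"

definition meetQ :: "'a \<Rightarrow> 'a \<Rightarrow> 'a"  (infixl "\<and>\<^sub>Q" 75)
  where "x \<and>\<^sub>Q y = ((x\<^sup>\<star> \<rightarrow> y\<^sup>\<star>) \<rightarrow> y\<^sup>\<star>)\<^sup>\<star>"

definition commutes :: "'a \<Rightarrow> 'a \<Rightarrow> bool"  (infix "\<C>" 50)
  where "x \<C> y \<longleftrightarrow> y \<and>\<^sub>Q x = (x \<rightarrow> y\<^sup>\<star>)\<^sup>\<star>"

definition center :: "'a set"
  where "center = {x \<in> X. \<forall>y \<in> X. x \<C> y}"

end

locale implicative_ortholattice = bounded_BE_algebra +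
  assumes involutive: "x \<in> X \<Longrightarrow> x\<^sup>\<star>\<^sup>\<star> = x"
    and implicative: "\<lbrakk>x \<in> X; y \<in> X\<rbrakk> \<Longrightarrow> (x \<rightarrow> y) \<rightarrow> x = x"

locale implicative_orthomodular_lattice = implicative_ortholattice +
  assumes orthomodular: "\<lbrakk>x \<in> X; y \<in> X\<rbrakk> \<Longrightarrow> x \<and>\<^sub>Q (y \<rightarrow> x) = x"

locale implicative_Boolean_algebra = implicative_ortholattice +
  assumes Boolean: "\<lbrakk>x \<in> X; y \<in> X\<rbrakk> \<Longrightarrow> (y\<^sup>\<star> \<rightarrow> x) \<rightarrow> y = x \<rightarrow> y"

definition implicative_Boolean_subalgebra ::
    "'a set \<Rightarrow> 'a set \<Rightarrow> ('a \<Rightarrow> 'a \<Rightarrow> 'a) \<Rightarrow> 'a \<Rightarrow> 'a \<Rightarrow> bool"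
  where "implicative_Boolean_subalgebra S X imp one zero \<longleftrightarrow>
    S \<subseteq> X \<and> zero \<in> S \<and> one \<in> S \<and> (\<forall>x \<in> S. \<forall>y \<in> S. imp x y \<in> S) \<and>
    implicative_Boolean_algebra S imp one zero"

end

theory Submission
  imports Defs
begin

text \<open>
  An implicative-ortholattice is an ortholattice in disguise.  Since \<open>x \<rightarrow> y = y\<^sup>\<star> \<rightarrow> x\<^sup>\<star>\<close>, the
  operation \<open>x \<squnion> y = x\<^sup>\<star> \<rightarrow> y\<close> is commutative, and the exchange law makes it associative; the
  implicative law is the absorption law.  So \<open>x \<rightarrow> y\<close> is the material implication \<open>x\<^sup>\<star> \<squnion> y\<close>,
  and \<open>x \<and>\<^sub>Q y\<close> is the Sasaki projection \<open>(x \<squnion> y\<^sup>\<star>) \<sqinter> y\<close>.  The identity \<open>x \<and>\<^sub>Q (y \<rightarrow> x) = x\<close> becomes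
  the orthomodular law, and \<open>x \<C> y\<close> becomes \<open>(y \<squnion> x\<^sup>\<star>) \<sqinter> x = x \<sqinter> y\<close>.

  With the orthomodular law, \<open>x \<C> y\<close> is a splitting of \<open>x\<close> along \<open>y\<close>, namely
  \<open>(x \<sqinter> y) \<squnion> (x \<sqinter> y\<^sup>\<star>) = x\<close> (\<open>commutes_iff_split\<close>), and \<open>\<C>\<close> is symmetric (\<open>commutes_sym\<close>).
  The splitting does not distinguish \<open>y\<close> from \<open>y\<^sup>\<star>\<close>, so the center is closed under \<open>\<^sup>\<star>\<close>.  If \<open>a\<close> and
  \<open>b\<close> are central, splitting \<open>y\<close> along \<open>a\<close> and then \<open>y \<sqinter> a\<close> along \<open>b\<close> writes \<open>y\<close> as the join
  of \<open>y \<sqinter> (a \<sqinter> b)\<close> and two elements whose join is \<open>y \<sqinter> (a \<sqinter> b)\<^sup>\<star>\<close>; hence \<open>a \<sqinter> b\<close> is central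
  (\<open>center_meet\<close>).  Therefore the center is closed under \<open>\<rightarrow>\<close>.  Finally, the Boolean
  identity says \<open>(y \<squnion> x)\<^sup>\<star> \<squnion> y = x\<^sup>\<star> \<squnion> y\<close>, which results from splitting \<open>x\<^sup>\<star>\<close> along \<open>y\<close>
  (\<open>Boolean_identity_if_commutes\<close>).
\<close>

section \<open>The ortholattice of an implicative-ortholattice\<close>

context implicative_ortholattice
begin

definition join :: "'a \<Rightarrow> 'a \<Rightarrow> 'a"  (infixl "\<squnion>" 76)
  where "x \<squnion> y = x\<^sup>\<star> \<rightarrow> y"

definition meet :: "'a \<Rightarrow> 'a \<Rightarrow> 'a"  (infixl "\<sqinter>" 77)
  where "x \<sqinter> y = (x\<^sup>\<star> \<squnion> y\<^sup>\<star>)\<^sup>\<star>"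

lemma neg_closed [simp]: "x \<in> X \<Longrightarrow> x\<^sup>\<star> \<in> X"
  by (simp add: neg_def imp_closed zero_closed)

lemma join_closed [simp]: "\<lbrakk>x \<in> X; y \<in> X\<rbrakk> \<Longrightarrow> x \<squnion> y \<in> X"
  by (simp add: join_def imp_closed)

lemma meet_closed [simp]: "\<lbrakk>x \<in> X; y \<in> X\<rbrakk> \<Longrightarrow> x \<sqinter> y \<in> X"
  by (simp add: meet_def)

lemmas [simp] = involutive zero_closed one_closed

lemma neg_zero: "\<zero>\<^sup>\<star> = \<one>"
  by (simp add: neg_def imp_refl)

lemma imp_eq_join: "x \<in> X \<Longrightarrow> x \<rightarrow> y = x\<^sup>\<star> \<squnion> y"
  by (simp add: join_def)

text \<open>Read \<open>y\<close> as \<open>y\<^sup>\<star> \<rightarrow> \<zero>\<close> and exchange the two premises.\<close>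

lemma contraposition:
  assumes "x \<in> X" "y \<in> X"
  shows "x \<rightarrow> y = y\<^sup>\<star> \<rightarrow> x\<^sup>\<star>"
proof -
  have "x \<rightarrow> y = x \<rightarrow> (y\<^sup>\<star> \<rightarrow> \<zero>)"
    using involutive[OF assms(2)] by (simp add: neg_def[of "y\<^sup>\<star>"])
  also have "\<dots> = y\<^sup>\<star> \<rightarrow> (x \<rightarrow> \<zero>)"
    using assms by (simp add: imp_exchange)
  finally show ?thesis
    by (simp add: neg_def[of x])
qed

lemma join_commute: "\<lbrakk>x \<in> X; y \<in> X\<rbrakk> \<Longrightarrow> x \<squnion> y = y \<squnion> x"
  using contraposition[of "x\<^sup>\<star>" y] by (simp add: join_def)

lemma join_left_commute: "\<lbrakk>x \<in> X; y \<in> X; z \<in> X\<rbrakk> \<Longrightarrow> x \<squnion> (y \<squnion> z) = y \<squnion> (x \<squnion> z)"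
  by (simp add: join_def imp_exchange)

lemma join_assoc:
  assumes "x \<in> X" "y \<in> X" "z \<in> X"
  shows "x \<squnion> y \<squnion> z = x \<squnion> (y \<squnion> z)"
  using assms join_commute[of "x \<squnion> y" z] join_left_commute[of z x y] join_commute[of z y] by simp

lemmas join_ac = join_assoc join_commute join_left_commute

lemma neg_join: "\<lbrakk>x \<in> X; y \<in> X\<rbrakk> \<Longrightarrow> (x \<squnion> y)\<^sup>\<star> = x\<^sup>\<star> \<sqinter> y\<^sup>\<star>"
  by (simp add: meet_def)

lemma neg_meet: "\<lbrakk>x \<in> X; y \<in> X\<rbrakk> \<Longrightarrow> (x \<sqinter> y)\<^sup>\<star> = x\<^sup>\<star> \<squnion> y\<^sup>\<star>"
  by (simp add: meet_def)

lemma meet_commute: "\<lbrakk>x \<in> X; y \<in> X\<rbrakk> \<Longrightarrow> x \<sqinter> y = y \<sqinter> x"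
  by (simp add: meet_def join_commute)

lemma meet_assoc: "\<lbrakk>x \<in> X; y \<in> X; z \<in> X\<rbrakk> \<Longrightarrow> x \<sqinter> y \<sqinter> z = x \<sqinter> (y \<sqinter> z)"
  by (simp add: meet_def join_assoc)

text \<open>The implicative law \<open>(x \<rightarrow> y\<^sup>\<star>) \<rightarrow> x = x\<close> with its outer arrow contraposed.\<close>

lemma join_meet_absorb: "\<lbrakk>x \<in> X; y \<in> X\<rbrakk> \<Longrightarrow> x \<squnion> (x \<sqinter> y) = x"
  using implicative[of x "y\<^sup>\<star>"] contraposition[of "x \<rightarrow> y\<^sup>\<star>" x]
  by (simp add: meet_def join_def imp_closed)

lemma meet_join_absorb:
  assumes "x \<in> X" "y \<in> X"
  shows "x \<sqinter> (x \<squnion> y) = x"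
  using assms join_meet_absorb[of "x\<^sup>\<star>" "y\<^sup>\<star>"] by (simp add: meet_def)

lemma meetQ_eq: "\<lbrakk>x \<in> X; y \<in> X\<rbrakk> \<Longrightarrow> x \<and>\<^sub>Q y = (x \<squnion> y\<^sup>\<star>) \<sqinter> y"
  by (simp add: meetQ_def meet_def join_def imp_closed)

lemma commutes_eq: "\<lbrakk>x \<in> X; y \<in> X\<rbrakk> \<Longrightarrow> x \<C> y \<longleftrightarrow> (y \<squnion> x\<^sup>\<star>) \<sqinter> x = x \<sqinter> y"
  by (simp add: commutes_def meetQ_eq meet_def imp_eq_join)

end

section \<open>Commutativity in an implicative-orthomodular lattice\<close>

context implicative_orthomodular_lattice
begin

text \<open>
  In the identity \<open>u \<and>\<^sub>Q (v \<rightarrow> u) = u\<close> the element \<open>v \<rightarrow> u = v\<^sup>\<star> \<squnion> u\<close> is an arbitrary upper bound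
  of \<open>u\<close>; the choice \<open>u = x \<sqinter> y\<close> and \<open>v = y\<^sup>\<star>\<close> makes it equal to \<open>y\<close>.
\<close>

lemma orthomodular_meet:
  assumes "x \<in> X" "y \<in> X"
  shows "((x \<sqinter> y) \<squnion> y\<^sup>\<star>) \<sqinter> y = x \<sqinter> y"
proof -
  have "y\<^sup>\<star> \<rightarrow> (x \<sqinter> y) = y"
    using assms join_meet_absorb[of y x] by (simp add: imp_eq_join meet_commute)
  then show ?thesis
    using assms orthomodular[of "x \<sqinter> y" "y\<^sup>\<star>"] by (simp add: meetQ_eq)
qed

text \<open>
  The dual form: an element \<open>p \<le> x\<close> has \<open>x \<sqinter> p\<^sup>\<star>\<close> as its relative complement in \<open>x\<close>.
  It comes from \<open>orthomodular_meet\<close> for \<open>x\<^sup>\<star> \<le> p\<^sup>\<star>\<close> by complementation.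
\<close>

lemma orthomodular_join:
  assumes "x \<in> X" "y \<in> X"
  shows "(x \<sqinter> y) \<squnion> (x \<sqinter> (x \<sqinter> y)\<^sup>\<star>) = x"
proof -
  define p where "p = x \<sqinter> y"
  have p: "p \<in> X" using assms by (simp add: p_def)
  have below: "x\<^sup>\<star> \<sqinter> p\<^sup>\<star> = x\<^sup>\<star>"
    using assms meet_join_absorb[of "x\<^sup>\<star>" "y\<^sup>\<star>"] by (simp add: p_def neg_meet)
  have "(x\<^sup>\<star> \<squnion> p) \<sqinter> p\<^sup>\<star> = x\<^sup>\<star>"
    using assms p orthomodular_meet[of "x\<^sup>\<star>" "p\<^sup>\<star>"] by (simp add: below)
  then have "((x\<^sup>\<star> \<squnion> p) \<sqinter> p\<^sup>\<star>)\<^sup>\<star> = x"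
    using assms by simp
  then have "(x \<sqinter> p\<^sup>\<star>) \<squnion> p = x"
    using assms p by (simp add: neg_meet neg_join)
  then show ?thesis
    using assms p by (simp add: p_def[symmetric] join_commute)
qed

text \<open>
  The element \<open>x \<sqinter> y\<^sup>\<star>\<close> lies below \<open>x\<close>, and its relative complement in \<open>x\<close> is \<open>x \<sqinter> (x\<^sup>\<star> \<squnion> y)\<close>,
  which is \<open>x \<sqinter> y\<close> when \<open>x \<C> y\<close>.
\<close>

lemma split_if_commutes:
  assumes "x \<in> X" "y \<in> X" "x \<C> y"
  shows "(x \<sqinter> y) \<squnion> (x \<sqinter> y\<^sup>\<star>) = x"
proof -
  have "x \<sqinter> (x \<sqinter> y\<^sup>\<star>)\<^sup>\<star> = (y \<squnion> x\<^sup>\<star>) \<sqinter> x"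
    using assms(1,2) by (simp add: neg_meet join_commute meet_commute)
  also have "\<dots> = x \<sqinter> y"
    using assms by (simp add: commutes_eq)
  finally show ?thesis
    using assms(1,2) orthomodular_join[of x "y\<^sup>\<star>"] by (simp add: join_commute)
qed

text \<open>
  Note the exchanged roles of \<open>x\<close> and \<open>y\<close> in the conclusion: together with \<open>split_if_commutes\<close>
  this gives symmetry and, applied twice, the converse of that lemma.
\<close>

lemma commutes_if_split:
  assumes x: "x \<in> X" and y: "y \<in> X" and split: "(x \<sqinter> y) \<squnion> (x \<sqinter> y\<^sup>\<star>) = x"
  shows "y \<C> x"
proof -
  have "x \<squnion> y\<^sup>\<star> = (x \<sqinter> y) \<squnion> (x \<sqinter> y\<^sup>\<star>) \<squnion> y\<^sup>\<star>"
    by (simp only: split)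
  also have "\<dots> = (x \<sqinter> y) \<squnion> (y\<^sup>\<star> \<squnion> (y\<^sup>\<star> \<sqinter> x))"
    using x y by (simp add: join_assoc join_commute[of "y\<^sup>\<star>"] meet_commute[of "y\<^sup>\<star>"])
  also have "\<dots> = (x \<sqinter> y) \<squnion> y\<^sup>\<star>"
    using x y by (simp add: join_meet_absorb)
  finally show ?thesis
    using x y orthomodular_meet[OF x y] by (simp add: commutes_eq meet_commute)
qed

lemma commutes_sym: "\<lbrakk>x \<in> X; y \<in> X; x \<C> y\<rbrakk> \<Longrightarrow> y \<C> x"
  by (simp add: commutes_if_split split_if_commutes)

lemma commutes_iff_split:
  "\<lbrakk>x \<in> X; y \<in> X\<rbrakk> \<Longrightarrow> x \<C> y \<longleftrightarrow> (x \<sqinter> y) \<squnion> (x \<sqinter> y\<^sup>\<star>) = x"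
  using commutes_if_split commutes_sym split_if_commutes by blast

lemma commutes_neg: "\<lbrakk>x \<in> X; y \<in> X; x \<C> y\<rbrakk> \<Longrightarrow> x \<C> y\<^sup>\<star>"
  by (simp add: commutes_iff_split join_commute)

text \<open>
  The component of \<open>x\<^sup>\<star>\<close> below \<open>y\<close> is absorbed when \<open>x\<^sup>\<star>\<close> is joined with \<open>y\<close>, which leaves
  \<open>x\<^sup>\<star> \<sqinter> y\<^sup>\<star> = (y\<^sup>\<star> \<rightarrow> x)\<^sup>\<star>\<close>.
\<close>

lemma Boolean_identity_if_commutes:
  assumes x: "x \<in> X" and y: "y \<in> X" and comm: "x\<^sup>\<star> \<C> y"
  shows "(y\<^sup>\<star> \<rightarrow> x) \<rightarrow> y = x \<rightarrow> y"
proof -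
  have "x \<rightarrow> y = (x\<^sup>\<star> \<sqinter> y) \<squnion> (x\<^sup>\<star> \<sqinter> y\<^sup>\<star>) \<squnion> y"
    using x y comm by (simp add: imp_eq_join split_if_commutes)
  also have "\<dots> = (x\<^sup>\<star> \<sqinter> y\<^sup>\<star>) \<squnion> (y \<squnion> (y \<sqinter> x\<^sup>\<star>))"
    using x y by (simp add: join_ac meet_commute)
  also have "\<dots> = (x\<^sup>\<star> \<sqinter> y\<^sup>\<star>) \<squnion> y"
    using x y by (simp add: join_meet_absorb)
  also have "\<dots> = (y\<^sup>\<star> \<rightarrow> x) \<rightarrow> y"
    using x y by (simp add: imp_eq_join neg_join meet_commute)
  finally show ?thesis ..
qed

section \<open>The center\<close>

lemma center_closed: "a \<in> center \<Longrightarrow> a \<in> X"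
  by (simp add: center_def)

text \<open>
  Centrality of \<open>a\<close> splits \<open>a\<close> along every \<open>y\<close>; symmetry of \<open>\<C>\<close> turns this into a splitting of
  every \<open>y\<close> along \<open>a\<close>, which is the form that closure under the operations needs.
\<close>

lemma center_iff_split:
  "a \<in> center \<longleftrightarrow> a \<in> X \<and> (\<forall>y \<in> X. (y \<sqinter> a) \<squnion> (y \<sqinter> a\<^sup>\<star>) = y)"
  using commutes_iff_split commutes_sym by (auto simp: center_def)

lemma center_neg: "a \<in> center \<Longrightarrow> a\<^sup>\<star> \<in> center"
  by (auto simp: center_iff_split join_commute)

text \<open>
  Splitting \<open>y\<close> along \<open>a\<close> and then \<open>y \<sqinter> a\<close> along \<open>b\<close> gives
  \<open>y = (y \<sqinter> a \<sqinter> b) \<squnion> (y \<sqinter> a \<sqinter> b\<^sup>\<star>) \<squnion> (y \<sqinter> a\<^sup>\<star>)\<close>.  The last two terms together are the splitting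
  of \<open>y \<sqinter> (a \<sqinter> b)\<^sup>\<star>\<close> along \<open>a\<close>.
\<close>

lemma center_meet:
  assumes a: "a \<in> center" and b: "b \<in> center"
  shows "a \<sqinter> b \<in> center"
proof -
  have ab: "a \<in> X" "b \<in> X" using a b by (auto intro: center_closed)
  have split_a: "(y \<sqinter> a) \<squnion> (y \<sqinter> a\<^sup>\<star>) = y" and split_b: "(y \<sqinter> b) \<squnion> (y \<sqinter> b\<^sup>\<star>) = y"
    if "y \<in> X" for y
    using that a b by (auto simp: center_iff_split)
  have "(y \<sqinter> (a \<sqinter> b)) \<squnion> (y \<sqinter> (a \<sqinter> b)\<^sup>\<star>) = y" if y: "y \<in> X" for y
  proof -
    let ?q = "y \<sqinter> (a \<sqinter> b)\<^sup>\<star>"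
    have "a \<C> b\<^sup>\<star>"
      using a ab by (simp add: center_def)
    then have "(a \<sqinter> b)\<^sup>\<star> \<sqinter> a = a \<sqinter> b\<^sup>\<star>"
      using ab by (simp add: commutes_eq neg_meet join_commute)
    then have q_a: "?q \<sqinter> a = y \<sqinter> a \<sqinter> b\<^sup>\<star>"
      using y ab by (simp add: meet_assoc)
    have "(a \<sqinter> b)\<^sup>\<star> \<sqinter> a\<^sup>\<star> = a\<^sup>\<star>"
      using ab meet_join_absorb[of "a\<^sup>\<star>" "b\<^sup>\<star>"] by (simp add: neg_meet meet_commute)
    then have q_neg_a: "?q \<sqinter> a\<^sup>\<star> = y \<sqinter> a\<^sup>\<star>"
      using y ab by (simp add: meet_assoc)
    have "y = (y \<sqinter> a \<sqinter> b) \<squnion> (y \<sqinter> a \<sqinter> b\<^sup>\<star>) \<squnion> (y \<sqinter> a\<^sup>\<star>)"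
      using y ab by (simp add: split_a split_b)
    also have "\<dots> = (y \<sqinter> a \<sqinter> b) \<squnion> ((?q \<sqinter> a) \<squnion> (?q \<sqinter> a\<^sup>\<star>))"
      unfolding q_a q_neg_a using y ab by (simp add: join_assoc)
    also have "\<dots> = (y \<sqinter> (a \<sqinter> b)) \<squnion> ?q"
      using y ab split_a[of ?q] meet_assoc[of y a b] by simp
    finally show ?thesis ..
  qed
  then show ?thesis
    using ab by (simp add: center_iff_split)
qed

lemma center_imp:
  assumes a: "a \<in> center" and b: "b \<in> center"
  shows "a \<rightarrow> b \<in> center"
proof -
  have ab: "a \<in> X" "b \<in> X" using a b by (auto intro: center_closed)
  have "(a \<sqinter> b\<^sup>\<star>)\<^sup>\<star> \<in> center"
    using a b by (intro center_neg center_meet)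
  then show ?thesis
    using ab by (simp add: imp_eq_join neg_meet)
qed

text \<open>
  Both sides of the commutativity condition for \<open>\<zero>\<close> are \<open>\<zero>\<close>, since \<open>\<zero>\<close> is a least element.
\<close>

lemma center_zero: "\<zero> \<in> center"
proof -
  have "\<zero> \<C> y" if "y \<in> X" for y
    using that zero_le[of "y\<^sup>\<star>"]
    by (simp add: commutes_def meetQ_def neg_zero le_def imp_one imp_closed)
  then show ?thesis
    by (simp add: center_def)
qed

lemma center_one: "\<one> \<in> center"
  using center_neg[OF center_zero] by (simp add: neg_zero)

lemma center_implicative_Boolean_algebra:
  "implicative_Boolean_algebra center imp one zero"
proof unfold_locales
  fix x y assume "x \<in> center" "y \<in> center"
  moreover from this have "x\<^sup>\<star> \<C> y"
    using center_neg by (auto simp: center_def)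
  ultimately show "(y\<^sup>\<star> \<rightarrow> x) \<rightarrow> y = x \<rightarrow> y"
    by (simp add: center_closed Boolean_identity_if_commutes)
qed (simp_all add: center_closed center_imp center_one center_zero imp_refl imp_one one_imp
       implicative zero_le imp_exchange)

end

theorem theorem5p12:
  fixes X :: "'a set" and imp :: "'a \<Rightarrow> 'a \<Rightarrow> 'a" and one zero :: 'a
  assumes "implicative_orthomodular_lattice X imp one zero"
  shows "implicative_Boolean_subalgebra (bounded_BE_algebra.center X imp zero) X imp one zero"
proof -
  interpret implicative_orthomodular_lattice X imp one zero by (fact assms)
  show ?thesis
    unfolding implicative_Boolean_subalgebra_def
    using center_closed center_zero center_one center_imp center_implicative_Boolean_algebra
    by blast
qed

end
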